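(* Let $G=(V,E)$ be a finite graph of maximum degree $\Delta$ with no isolated vertices, and write $d_u$ for the degree of $u$. Let $b\in\{0\}\cup[1,\infty)$ and assume $\mathrm{mad}(G[N(u)])\le b$ for every $u\in V$. Set $c(0)=0.109597$ and, for $b\ge 1$, $c(b)=0.0896883/b$. Let $0<\lambda<c(b)/\Delta$ and for each $u\in V$ define \[ D_u := d_u(1+\lambda)^b\log(1+\lambda),\qquad \beta_u := \frac{1+\lambda}{\lambda}\cdot\frac{D_u}{W(D_u)(1+W(D_u))},\qquad \gamma_u := \frac{1+\lambda}{\lambda}\cdot\frac{D_u}{d_u(1+W(D_u))}. \] Then \[ \mathbb{E}_{G,\lambda\mathbf 1}|I| \;\ge\; \sum_{u\in V}\frac{1}{\beta_u+d_u\gamma_u}. \]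
   Context: The hard-core model on a graph $G=(V,E)$ with fugacity vector $\boldsymbol\lambda\in[0,\infty)^V$ is the probability measure on the set $\mathcal I(G)$ of independent sets with $\Pr_{G,\boldsymbol\lambda}(I)=\frac{1}{Z_G(\boldsymbol\lambda)}\prod_{v\in I}\lambda_v$, $Z_G(\boldsymbol\lambda)=\sum_{J\in\mathcal I(G)}\prod_{v\in J}\lambda_v$; $\mathbb{E}_{G,\boldsymbol\lambda}$ denotes expectation and $I$ the random independent set; $\lambda\mathbf 1$ is the constant vector with all entries $\lambda$. $N(u)$ is the neighborhood of $u$ and $G[N(u)]$ the induced subgraph. For a graph $H$, the maximum average degree is $\mathrm{mad}(H)=\max_{F\subseteq H,\,|V(F)|>0} 2|E(F)|/|V(F)|$ (maximum over subgraphs $F$); $\mathrm{mad}$ of the empty graph is taken as $0$. $W:(0,\infty)\to(0,\infty)$ is the principal branch of the Lambert $W$-function, i.e. the inverse of $x\mapsto xe^x$ on $(0,\infty)$. *)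

theory Defs
  imports Complex_Main
begin

definition simple_graph :: "'a set \<Rightarrow> 'a set set \<Rightarrow> bool" where
  "simple_graph V E \<longleftrightarrow> finite V \<and> (\<forall>e\<in>E. \<exists>u v. u \<noteq> v \<and> e = {u, v} \<and> u \<in> V \<and> v \<in> V)"

definition nbhd :: "'a set set \<Rightarrow> 'a \<Rightarrow> 'a set" where
  "nbhd E u = {v. {u, v} \<in> E}"

definition degree :: "'a set set \<Rightarrow> 'a \<Rightarrow> nat" where
  "degree E u = card (nbhd E u)"

definition max_degree :: "'a set \<Rightarrow> 'a set set \<Rightarrow> nat" where
  "max_degree V E = Max (degree E ` V)"

definition induced_edges :: "'a set set \<Rightarrow> 'a set \<Rightarrow> 'a set set" where
  "induced_edges E S = {e \<in> E. e \<subseteq> S}"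

definition mad :: "'a set \<Rightarrow> 'a set set \<Rightarrow> real" where
  "mad V E = (if V = {} then 0 else
     Max {2 * real (card FE) / real (card FV) | FV FE.
            FV \<subseteq> V \<and> FV \<noteq> {} \<and> FE \<subseteq> E \<and> (\<forall>e\<in>FE. e \<subseteq> FV)})"

definition indep_sets :: "'a set \<Rightarrow> 'a set set \<Rightarrow> 'a set set" where
  "indep_sets V E = {I. I \<subseteq> V \<and> (\<forall>e\<in>E. \<not> e \<subseteq> I)}"

definition hc_weight :: "('a \<Rightarrow> real) \<Rightarrow> 'a set \<Rightarrow> real" where
  "hc_weight lam I = (\<Prod>v\<in>I. lam v)"

definition hc_Z :: "'a set \<Rightarrow> 'a set set \<Rightarrow> ('a \<Rightarrow> real) \<Rightarrow> real" where
  "hc_Z V E lam = (\<Sum>J\<in>indep_sets V E. hc_weight lam J)"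

definition hc_prob :: "'a set \<Rightarrow> 'a set set \<Rightarrow> ('a \<Rightarrow> real) \<Rightarrow> 'a set \<Rightarrow> real" where
  "hc_prob V E lam I = hc_weight lam I / hc_Z V E lam"

definition hc_expected_size :: "'a set \<Rightarrow> 'a set set \<Rightarrow> ('a \<Rightarrow> real) \<Rightarrow> real" where
  "hc_expected_size V E lam = (\<Sum>I\<in>indep_sets V E. real (card I) * hc_prob V E lam I)"

definition lambertW :: "real \<Rightarrow> real" where
  "lambertW y = (THE w. w > 0 \<and> w * exp w = y)"

definition cconst :: "real \<Rightarrow> real" where
  "cconst b = (if b = 0 then 0.109597 else 0.0896883 / b)"

end

theory Submission
  imports Defs "HOL-Analysis.Convex"
begin

text \<open>Let \<open>q u\<close> be the probability that no neighbour of \<open>u\<close> is occupied, so that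
  \<open>E|I| = lam / (1 + lam) * (\<Sum>u\<in>V. q u)\<close>, and put \<open>\<kappa> = (1 + lam) powr b * ln (1 + lam)\<close>.
  Resampling the neighbourhood of \<open>u\<close> gives \<open>q u \<ge> exp (- \<kappa> * (\<Sum>v\<in>N u. q v))\<close>, while the claimed
  summand simplifies to \<open>lam / (1 + lam) * g u\<close> where \<open>g u = exp (- W (D u))\<close> solves the
  degree-regular version \<open>g u = exp (- \<kappa> * d u * g u)\<close>.
  With the graph Laplacian \<open>L\<close>, the tangent line at \<open>g\<close> turns this into \<open>q \<ge> g + h * L q\<close>
  for \<open>h = \<kappa> * g / (1 + W)\<close>. Solve \<open>y = h + h * L y\<close> and pair the inequality with the
  nonnegative weight \<open>1 + L y\<close>: by symmetry of \<open>L\<close> the sum of \<open>q\<close> is at least the sum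
  of \<open>g\<close> plus \<open>\<langle>g, L y\<rangle>\<close>. Since \<open>g\<close> and \<open>h\<close> both decrease with the degree, the leading
  term \<open>\<langle>g, L h\<rangle>\<close> dominates the Dirichlet energy of \<open>g\<close>, and for \<open>\<kappa> * \<Delta> \<le> 1 / 8\<close> this absorbs
  the rest of the Neumann series.\<close>

section \<open>The graph Laplacian\<close>

text \<open>The Laplacian argument sees the graph only through a symmetric neighbourhood map on a
  finite set; it is later instantiated with \<open>nbhd E\<close>.\<close>

locale nbhd_system =
  fixes V :: "'a set" and N :: "'a \<Rightarrow> 'a set"
  assumes finite_V: "finite V"
    and N_subset: "u \<in> V \<Longrightarrow> N u \<subseteq> V"
    and N_sym: "v \<in> N u \<Longrightarrow> u \<in> N v"
begin

definition lap :: "('a \<Rightarrow> real) \<Rightarrow> 'a \<Rightarrow> real" where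
  "lap a u = (\<Sum>v\<in>N u. a u - a v)"

text \<open>Polarised Dirichlet form over ordered pairs, so each edge counts twice; hence the factor
  1/2 in \<open>sum_mult_lap\<close>.\<close>

definition energy :: "('a \<Rightarrow> real) \<Rightarrow> ('a \<Rightarrow> real) \<Rightarrow> real" where
  "energy a b = (\<Sum>u\<in>V. \<Sum>v\<in>N u. (a u - a v) * (b u - b v))"

lemma finite_N: "u \<in> V \<Longrightarrow> finite (N u)"
  using N_subset finite_V finite_subset by blast

text \<open>Reversing direction is a bijection on the oriented edges.\<close>

lemma sum_N_swap: "(\<Sum>u\<in>V. \<Sum>v\<in>N u. f u v) = (\<Sum>u\<in>V. \<Sum>v\<in>N u. (f v u :: real))"
proof -
  have "(\<Sum>u\<in>V. \<Sum>v\<in>N u. f u v) = (\<Sum>(u,v)\<in>Sigma V N. f u v)"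
    using finite_V finite_N by (subst sum.Sigma) auto
  also have "\<dots> = (\<Sum>(u,v)\<in>Sigma V N. f v u)"
    by (rule sum.reindex_bij_witness[where i = "\<lambda>(u,v). (v,u)" and j = "\<lambda>(u,v). (v,u)"])
      (use N_subset N_sym in auto)
  also have "\<dots> = (\<Sum>u\<in>V. \<Sum>v\<in>N u. f v u)"
    using finite_V finite_N by (subst sum.Sigma) auto
  finally show ?thesis .
qed

text \<open>Summation by parts: the sum is averaged with its copy under edge reversal.\<close>

lemma sum_mult_lap: "(\<Sum>u\<in>V. a u * lap b u) = energy a b / 2"
proof -
  have "(\<Sum>u\<in>V. a u * lap b u) = (\<Sum>u\<in>V. \<Sum>v\<in>N u. a u * (b u - b v))"
    by (simp add: lap_def sum_distrib_left)
  moreover from this have "(\<Sum>u\<in>V. a u * lap b u) = (\<Sum>u\<in>V. \<Sum>v\<in>N u. a v * (b v - b u))"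
    using sum_N_swap[of "\<lambda>u v. a u * (b u - b v)"] by simp
  moreover have "energy a b = (\<Sum>u\<in>V. \<Sum>v\<in>N u. a u * (b u - b v)) + (\<Sum>u\<in>V. \<Sum>v\<in>N u. a v * (b v - b u))"
    unfolding energy_def sum.distrib[symmetric]
    by (intro sum.cong refl) (simp add: algebra_simps)
  ultimately show ?thesis by simp
qed

lemma energy_commute: "energy a b = energy b a"
  by (simp add: energy_def mult.commute)

lemma sum_mult_lap_commute: "(\<Sum>u\<in>V. a u * lap b u) = (\<Sum>u\<in>V. lap a u * b u)"
  using sum_mult_lap[of a b] sum_mult_lap[of b a] energy_commute[of a b]
  by (simp add: mult.commute)

lemma lap_add: "lap (\<lambda>u. a u + b u) u = lap a u + lap b u"
  by (simp add: lap_def sum.distrib[symmetric] algebra_simps)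

lemma lap_cong: "(\<And>u. u \<in> V \<Longrightarrow> a u = b u) \<Longrightarrow> u \<in> V \<Longrightarrow> lap a u = lap b u"
  unfolding lap_def using N_subset by (intro sum.cong) auto

lemma energy_self_nonneg: "energy a a \<ge> 0"
  unfolding energy_def by (intro sum_nonneg) auto

section \<open>Operator bounds, resolvent and comparison principle under a degree bound\<close>

context
  fixes \<Delta> :: real
  assumes card_N: "u \<in> V \<Longrightarrow> real (card (N u)) \<le> \<Delta>" and \<Delta>_nonneg: "\<Delta> \<ge> 0"
begin

lemma abs_lap_le:
  assumes "\<And>v. v \<in> V \<Longrightarrow> \<bar>a v\<bar> \<le> c" "u \<in> V"
  shows "\<bar>lap a u\<bar> \<le> 2 * \<Delta> * c"
proof -
  have c: "c \<ge> 0" using assms(1)[OF assms(2)] by linarith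
  have "\<bar>lap a u\<bar> \<le> (\<Sum>v\<in>N u. \<bar>a u - a v\<bar>)"
    unfolding lap_def by (rule sum_abs)
  also have "\<dots> \<le> (\<Sum>v\<in>N u. 2 * c)"
  proof (rule sum_mono)
    fix v assume "v \<in> N u"
    then have "v \<in> V" using N_subset assms(2) by auto
    then show "\<bar>a u - a v\<bar> \<le> 2 * c"
      using assms(1)[of v] assms(1)[OF assms(2)] by linarith
  qed
  also have "\<dots> \<le> 2 * \<Delta> * c"
    using card_N[OF assms(2)] c by (simp add: mult_right_mono)
  finally show ?thesis .
qed

text \<open>Cauchy-Schwarz over the at most \<Delta> neighbours of each vertex.\<close>

lemma sum_lap_square_le: "(\<Sum>u\<in>V. (lap a u)\<^sup>2) \<le> \<Delta> * energy a a"
proof -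
  have "(\<Sum>u\<in>V. (lap a u)\<^sup>2) \<le> (\<Sum>u\<in>V. \<Delta> * (\<Sum>v\<in>N u. (a u - a v)\<^sup>2))"
  proof (rule sum_mono)
    fix u assume u: "u \<in> V"
    have "(lap a u)\<^sup>2 \<le> real (card (N u)) * (\<Sum>v\<in>N u. (a u - a v)\<^sup>2)"
      unfolding lap_def using sum_squared_le_sum_of_squares[of "\<lambda>v. a u - a v" "N u"]
      by (simp add: mult.commute)
    also have "\<dots> \<le> \<Delta> * (\<Sum>v\<in>N u. (a u - a v)\<^sup>2)"
      by (intro mult_right_mono card_N u sum_nonneg) auto
    finally show "(lap a u)\<^sup>2 \<le> \<Delta> * (\<Sum>v\<in>N u. (a u - a v)\<^sup>2)" .
  qed
  then show ?thesis
    by (simp add: energy_def sum_distrib_left power2_eq_square)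
qed

text \<open>From \<open>(x - y)\<^sup>2 \<le> 2 * x\<^sup>2 + 2 * y\<^sup>2\<close>; edge reversal
  then moves every square to the base vertex, where it is counted once per neighbour.\<close>

lemma energy_self_le: "energy a a \<le> 4 * \<Delta> * (\<Sum>u\<in>V. (a u)\<^sup>2)"
proof -
  have "energy a a \<le> (\<Sum>u\<in>V. \<Sum>v\<in>N u. 2 * (a u)\<^sup>2 + 2 * (a v)\<^sup>2)"
    unfolding energy_def
  proof (intro sum_mono)
    fix u v
    have "0 \<le> (a u + a v)\<^sup>2" by simp
    then show "(a u - a v) * (a u - a v) \<le> 2 * (a u)\<^sup>2 + 2 * (a v)\<^sup>2"
      by (simp add: power2_eq_square algebra_simps)
  qed
  also have "\<dots> = (\<Sum>u\<in>V. \<Sum>v\<in>N u. 4 * (a u)\<^sup>2)"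
    unfolding sum.distrib sum_N_swap[of "\<lambda>u v. 2 * (a v)\<^sup>2"]
    by (simp add: sum.distrib[symmetric] mult_ac)
  also have "\<dots> = (\<Sum>u\<in>V. 4 * (a u)\<^sup>2 * real (card (N u)))"
    by (simp add: mult_ac)
  also have "\<dots> \<le> (\<Sum>u\<in>V. 4 * (a u)\<^sup>2 * \<Delta>)"
    by (intro sum_mono mult_left_mono card_N) auto
  finally show ?thesis by (simp add: sum_distrib_left mult_ac)
qed

text \<open>Neumann series: by \<open>abs_lap_le\<close> the operator sending \<open>x\<close> to
  \<open>h * lap x\<close> has sup norm at most 2 \<kappa> \<Delta> \<le> 1/4, so its iterates on
  \<open>h\<close> decay geometrically, and 4/3 is the sum of the powers of 1/4.\<close>

lemma ex_resolvent:
  assumes h: "\<And>u. u \<in> V \<Longrightarrow> 0 \<le> h u" "\<And>u. u \<in> V \<Longrightarrow> h u \<le> \<kappa>"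
    and small: "\<kappa> * \<Delta> \<le> 1 / 8"
  obtains y where "\<And>u. u \<in> V \<Longrightarrow> y u = h u + h u * lap y u"
    and "\<And>u. u \<in> V \<Longrightarrow> \<bar>y u\<bar> \<le> 4 / 3 * \<kappa>"
proof -
  define a where "a k = ((\<lambda>x u. h u * lap x u) ^^ k) h" for k
  have a0: "a 0 = h" and aS: "a (Suc k) = (\<lambda>u. h u * lap (a k) u)" for k
    by (simp_all add: a_def)
  have bound: "\<bar>a k u\<bar> \<le> \<kappa> * (1/4)^k" if "u \<in> V" for u k
    using that
  proof (induction k arbitrary: u)
    case 0
    then show ?case using h[OF 0] by (simp add: a0)
  next
    case (Suc k)
    have "\<kappa> \<ge> 0" using h[OF Suc.prems] by linarith
    have "\<bar>a (Suc k) u\<bar> = h u * \<bar>lap (a k) u\<bar>"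
      using h[OF Suc.prems] by (simp add: aS abs_mult)
    also have "\<dots> \<le> \<kappa> * (2 * \<Delta> * (\<kappa> * (1/4)^k))"
      using h[OF Suc.prems] abs_lap_le[OF Suc.IH Suc.prems]
      by (intro mult_mono) auto
    also have "\<dots> = 2 * (\<kappa> * \<Delta>) * (\<kappa> * (1/4)^k)" by simp
    also have "\<dots> \<le> 2 * (1/8) * (\<kappa> * (1/4)^k)"
      using small \<open>\<kappa> \<ge> 0\<close> by (intro mult_right_mono) auto
    finally show ?case by simp
  qed
  have geo: "(\<lambda>k. \<kappa> * (1/4)^k) sums (\<kappa> * (4/3))"
    using sums_mult[OF geometric_sums[of "1/4::real"], of \<kappa>] by simp
  have abs_summ: "summable (\<lambda>k. \<bar>a k u\<bar>)" if "u \<in> V" for u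
    by (rule summable_comparison_test'[OF sums_summable[OF geo]])
      (use bound[OF that] in auto)
  have summ: "summable (\<lambda>k. a k u)" if "u \<in> V" for u
    by (rule summable_rabs_cancel[OF abs_summ[OF that]])
  define y where "y u = (\<Sum>k. a k u)" for u
  have "y u = h u + h u * lap y u" if u: "u \<in> V" for u
  proof -
    \<comment> \<open>Neighbourhoods are finite, so \<open>lap\<close> commutes with the series;
      multiplying by \<open>h\<close> then shifts the series by one index, and the missing head is
      \<open>h\<close>.\<close>
    have "lap y u = (\<Sum>v\<in>N u. \<Sum>k. a k u - a k v)"
      unfolding lap_def y_def using N_subset[OF u] u summ
      by (intro sum.cong refl suminf_diff) auto
    also have "\<dots> = (\<Sum>k. lap (a k) u)"
      unfolding lap_def using N_subset[OF u] u summ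
      by (intro suminf_sum[symmetric] summable_diff) auto
    finally have *: "lap y u = (\<Sum>k. lap (a k) u)" .
    have "summable (\<lambda>k. lap (a k) u)"
      unfolding lap_def using N_subset[OF u] u summ
      by (intro summable_sum summable_diff) auto
    then have "h u * lap y u = (\<Sum>k. a (Suc k) u)"
      by (simp add: * aS suminf_mult)
    then show ?thesis
      using suminf_split_head[OF summ[OF u]] by (simp add: y_def a0)
  qed
  moreover have "\<bar>y u\<bar> \<le> 4 / 3 * \<kappa>" if u: "u \<in> V" for u
  proof -
    have "\<bar>y u\<bar> \<le> (\<Sum>k. \<bar>a k u\<bar>)"
      unfolding y_def by (rule summable_rabs[OF abs_summ[OF u]])
    also have "\<dots> \<le> (\<Sum>k. \<kappa> * (1/4)^k)"
      using bound[OF u] abs_summ[OF u] sums_summable[OF geo] by (intro suminf_le) auto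
    also have "\<dots> = 4/3 * \<kappa>" using sums_unique[OF geo] by simp
    finally show ?thesis .
  qed
  ultimately show thesis using that by blast
qed

text \<open>Write \<open>y = h + \<eta>\<close>. The main term \<open>energy g h / 2\<close> is at
  least 4/9 \<kappa> times the energy of \<open>g\<close> by \<open>lower\<close>. The remainder,
  rewritten with \<open>lap g\<close> by self-adjointness, is smaller by a factor of order \<kappa>
  \<Delta>.\<close>

lemma resolvent_pairing_nonneg:
  assumes h: "\<And>u. u \<in> V \<Longrightarrow> 0 \<le> h u" "\<And>u. u \<in> V \<Longrightarrow> h u \<le> \<kappa>"
    and \<kappa>: "\<kappa> > 0" and small: "\<kappa> * \<Delta> \<le> 1 / 8"
    and y: "\<And>u. u \<in> V \<Longrightarrow> y u = h u + h u * lap y u"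
    and lower: "\<And>u v. u \<in> V \<Longrightarrow> v \<in> V \<Longrightarrow> 8/9 * \<kappa> * (g u - g v)\<^sup>2 \<le> (g u - g v) * (h u - h v)"
    and upper: "\<And>u v. u \<in> V \<Longrightarrow> v \<in> V \<Longrightarrow> \<bar>h u - h v\<bar> \<le> 2 * \<kappa> * \<bar>g u - g v\<bar>"
  shows "0 \<le> (\<Sum>u\<in>V. g u * lap y u)"
proof -
  define \<eta> where "\<eta> u = h u * lap y u" for u
  have lap_y: "lap y u = lap h u + lap \<eta> u" if "u \<in> V" for u
    using lap_cong[of y "\<lambda>u. h u + \<eta> u" u] that y by (simp add: \<eta>_def[symmetric] lap_add)
  define S where "S = energy g g"
  have S: "S \<ge> 0" by (simp add: S_def energy_self_nonneg)
  have gh: "8/9 * \<kappa> * S \<le> energy g h"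
    unfolding S_def energy_def sum_distrib_left
    by (intro sum_mono) (use lower N_subset in \<open>auto simp: power2_eq_square mult.assoc\<close>)
  have hh: "energy h h \<le> 4 * \<kappa>\<^sup>2 * S"
    unfolding S_def energy_def sum_distrib_left
  proof (intro sum_mono)
    fix u v assume "u \<in> V" "v \<in> N u"
    then have "\<bar>h u - h v\<bar> \<le> 2 * \<kappa> * \<bar>g u - g v\<bar>" using upper N_subset by blast
    then have "\<bar>h u - h v\<bar>\<^sup>2 \<le> (2 * \<kappa> * \<bar>g u - g v\<bar>)\<^sup>2" by (intro power_mono) auto
    then have "(h u - h v)\<^sup>2 \<le> 4 * \<kappa>\<^sup>2 * (g u - g v)\<^sup>2"
      by (simp add: power_mult_distrib)
    then show "(h u - h v) * (h u - h v) \<le> 4 * \<kappa>\<^sup>2 * ((g u - g v) * (g u - g v))"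
      by (simp add: power2_eq_square)
  qed
  define R where "R = (\<Sum>u\<in>V. (\<eta> u)\<^sup>2)"
  have R: "R \<ge> 0" unfolding R_def by (intro sum_nonneg) auto
  \<comment> \<open>As \<open>\<eta> = h * (lap h + lap \<eta>)\<close>, the quantity
    \<open>R\<close> reappears on the right; its coefficient
    \<open>8 * (\<kappa> * \<Delta>)\<^sup>2 \<le> 1/8\<close> lets it be absorbed, which leaves the
    factor 8 / (7/8) = 64/7.\<close>
  have "R \<le> (\<Sum>u\<in>V. 2 * \<kappa>\<^sup>2 * ((lap h u)\<^sup>2 + (lap \<eta> u)\<^sup>2))"
    unfolding R_def
  proof (rule sum_mono)
    fix u assume u: "u \<in> V"
    have "0 \<le> (lap h u - lap \<eta> u)\<^sup>2" by simp
    then have "(lap y u)\<^sup>2 \<le> 2 * ((lap h u)\<^sup>2 + (lap \<eta> u)\<^sup>2)"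
      by (simp add: lap_y[OF u] power2_eq_square algebra_simps)
    moreover have "(h u)\<^sup>2 \<le> \<kappa>\<^sup>2" using h[OF u] by (intro power_mono) auto
    ultimately have "(h u)\<^sup>2 * (lap y u)\<^sup>2 \<le> \<kappa>\<^sup>2 * (2 * ((lap h u)\<^sup>2 + (lap \<eta> u)\<^sup>2))"
      by (intro mult_mono) auto
    then show "(\<eta> u)\<^sup>2 \<le> 2 * \<kappa>\<^sup>2 * ((lap h u)\<^sup>2 + (lap \<eta> u)\<^sup>2)"
      by (simp add: \<eta>_def power_mult_distrib algebra_simps)
  qed
  also have "\<dots> = 2 * \<kappa>\<^sup>2 * ((\<Sum>u\<in>V. (lap h u)\<^sup>2) + (\<Sum>u\<in>V. (lap \<eta> u)\<^sup>2))"
    by (simp only: sum_distrib_left sum.distrib[symmetric])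
  also have "\<dots> \<le> 2 * \<kappa>\<^sup>2 * (\<Delta> * energy h h + \<Delta> * energy \<eta> \<eta>)"
    by (intro mult_left_mono add_mono sum_lap_square_le) auto
  also have "\<dots> \<le> 2 * \<kappa>\<^sup>2 * (\<Delta> * (4 * \<kappa>\<^sup>2 * S) + \<Delta> * (4 * \<Delta> * R))"
    using hh energy_self_le[of \<eta>] \<Delta>_nonneg
    by (intro mult_left_mono add_mono) (auto simp: R_def)
  also have "\<dots> = 8 * \<kappa>^4 * \<Delta> * S + 8 * (\<kappa> * \<Delta>)\<^sup>2 * R"
    by (simp add: power2_eq_square power4_eq_xxxx algebra_simps)
  finally have "R \<le> 8 * \<kappa>^4 * \<Delta> * S + 8 * ((\<kappa> * \<Delta>)\<^sup>2 * R)" by simp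
  moreover have "(\<kappa> * \<Delta>)\<^sup>2 * R \<le> (1/8)\<^sup>2 * R"
    using small \<kappa> \<Delta>_nonneg R by (intro mult_right_mono power_mono) auto
  then have "(\<kappa> * \<Delta>)\<^sup>2 * R \<le> R / 64" by (simp add: power2_eq_square)
  ultimately have R_le: "R \<le> 64 / 7 * (\<kappa>^4 * \<Delta> * S)" by simp
  \<comment> \<open>Young's inequality. The weights 3/2 and 1/6 have product 1/4 and make the two
    contributions, 3/2 and 32/21, nearly equal.\<close>
  have "- (\<Sum>u\<in>V. lap g u * \<eta> u) \<le> (\<Sum>u\<in>V. 3 / 2 * \<kappa>\<^sup>2 * (lap g u)\<^sup>2 + (\<eta> u)\<^sup>2 / (6 * \<kappa>\<^sup>2))"
    unfolding sum_negf[symmetric]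
  proof (rule sum_mono)
    fix u
    have "0 \<le> (3 * \<kappa>\<^sup>2 * lap g u + \<eta> u)\<^sup>2 / (6 * \<kappa>\<^sup>2)" by simp
    also have "\<dots> = 3 / 2 * \<kappa>\<^sup>2 * (lap g u)\<^sup>2 + (\<eta> u)\<^sup>2 / (6 * \<kappa>\<^sup>2) + lap g u * \<eta> u"
      using \<kappa> by (simp add: field_simps power2_eq_square)
    finally show "- (lap g u * \<eta> u) \<le> 3 / 2 * \<kappa>\<^sup>2 * (lap g u)\<^sup>2 + (\<eta> u)\<^sup>2 / (6 * \<kappa>\<^sup>2)" by linarith
  qed
  also have "\<dots> = 3 / 2 * \<kappa>\<^sup>2 * (\<Sum>u\<in>V. (lap g u)\<^sup>2) + R / (6 * \<kappa>\<^sup>2)"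
    by (simp add: R_def sum.distrib sum_distrib_left sum_divide_distrib)
  also have "\<dots> \<le> 3 / 2 * \<kappa>\<^sup>2 * (\<Delta> * S) + (64 / 7 * (\<kappa>^4 * \<Delta> * S)) / (6 * \<kappa>\<^sup>2)"
    unfolding S_def using R_le
    by (intro add_mono mult_left_mono sum_lap_square_le divide_right_mono) (auto simp: S_def)
  also have "\<dots> = (3 / 2 + 32 / 21) * (\<kappa> * \<Delta>) * (\<kappa> * S)"
    using \<kappa> by (simp add: field_simps power2_eq_square power4_eq_xxxx)
  also have "\<dots> \<le> (3 / 2 + 32 / 21) * (1 / 8) * (\<kappa> * S)"
    using small \<kappa> S by (intro mult_right_mono mult_left_mono) auto
  \<comment> \<open>The constant so far is 127/336, below the 4/9 that the main term
    supplies.\<close>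
  also have "\<dots> \<le> 4 / 9 * \<kappa> * S"
    using \<kappa> S by simp
  finally have "- (\<Sum>u\<in>V. lap g u * \<eta> u) \<le> 4 / 9 * \<kappa> * S" .
  moreover have "(\<Sum>u\<in>V. g u * lap y u) = energy g h / 2 + (\<Sum>u\<in>V. lap g u * \<eta> u)"
    unfolding sum_mult_lap[symmetric] sum_mult_lap_commute[symmetric]
    by (simp add: sum.distrib[symmetric] distrib_left[symmetric] lap_y)
  ultimately show ?thesis using gh by linarith
qed

text \<open>Duality: the pointwise inequality is tested against the weight \<open>1 + lap y\<close>,
  for which \<open>h * (1 + lap y) = y\<close>. Besides the sums of \<open>q\<close> and
  \<open>g\<close>, only the pairing of \<open>g\<close> with \<open>lap y\<close> survives.\<close>

theorem sum_ge_of_laplacian_supersolution: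
  assumes h: "\<And>u. u \<in> V \<Longrightarrow> 0 \<le> h u" "\<And>u. u \<in> V \<Longrightarrow> h u \<le> \<kappa>"
    and \<kappa>: "\<kappa> > 0" and small: "\<kappa> * \<Delta> \<le> 1 / 8"
    and lower: "\<And>u v. u \<in> V \<Longrightarrow> v \<in> V \<Longrightarrow> 8/9 * \<kappa> * (g u - g v)\<^sup>2 \<le> (g u - g v) * (h u - h v)"
    and upper: "\<And>u v. u \<in> V \<Longrightarrow> v \<in> V \<Longrightarrow> \<bar>h u - h v\<bar> \<le> 2 * \<kappa> * \<bar>g u - g v\<bar>"
    and q: "\<And>u. u \<in> V \<Longrightarrow> g u + h u * lap q u \<le> q u"
  shows "(\<Sum>u\<in>V. g u) \<le> (\<Sum>u\<in>V. q u)"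
proof -
  obtain y where y: "\<And>u. u \<in> V \<Longrightarrow> y u = h u + h u * lap y u"
    and y_le: "\<And>u. u \<in> V \<Longrightarrow> \<bar>y u\<bar> \<le> 4 / 3 * \<kappa>"
    using ex_resolvent[of h \<kappa>, OF h small] by blast
  have "0 \<le> (\<Sum>u\<in>V. (1 + lap y u) * (q u - h u * lap q u - g u))"
  proof (intro sum_nonneg mult_nonneg_nonneg)
    fix u assume u: "u \<in> V"
    show "0 \<le> q u - h u * lap q u - g u" using q[OF u] by simp
    \<comment> \<open>The right side is at most 1/3, so the weight is at least 2/3.\<close>
    have "\<bar>lap y u\<bar> \<le> 2 * \<Delta> * (4 / 3 * \<kappa>)" by (rule abs_lap_le[OF y_le u])
    then show "0 \<le> 1 + lap y u" using small by (simp add: mult.commute)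
  qed
  \<comment> \<open>The first two terms of the new summand cancel after summation because
    \<open>lap\<close> is self-adjoint.\<close>
  also have "\<dots> = (\<Sum>u\<in>V. q u * lap y u - y u * lap q u + (q u - g u) - g u * lap y u)"
  proof (rule sum.cong[OF refl])
    fix u assume "u \<in> V"
    then have *: "y u * lap q u = (h u + h u * lap y u) * lap q u" using y by simp
    show "(1 + lap y u) * (q u - h u * lap q u - g u)
        = q u * lap y u - y u * lap q u + (q u - g u) - g u * lap y u"
      unfolding * by (simp add: algebra_simps)
  qed
  also have "\<dots> = (\<Sum>u\<in>V. q u) - (\<Sum>u\<in>V. g u) - (\<Sum>u\<in>V. g u * lap y u)"
    using sum_mult_lap_commute[of q y] by (simp add: sum.distrib sum_subtractf mult.commute)
  finally show ?thesis
    using resolvent_pairing_nonneg[of h \<kappa> y g, OF h \<kappa> small y lower upper] by linarith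
qed

end

end

section \<open>Partition functions of the hard-core model\<close>

lemma finite_indep_sets: "finite F \<Longrightarrow> finite (indep_sets F E)"
  unfolding indep_sets_def by (rule finite_subset[of _ "Pow F"]) auto

lemma finite_of_indep: "finite F \<Longrightarrow> I \<in> indep_sets F E \<Longrightarrow> finite I"
  unfolding indep_sets_def using finite_subset by auto

locale hard_core =
  fixes E :: "'a set set" and lam :: real
  assumes edge: "e \<in> E \<Longrightarrow> \<exists>u v. u \<noteq> v \<and> e = {u, v}"
    and lam_pos: "lam > 0"
begin

lemma nbhd_sym: "v \<in> nbhd E u \<Longrightarrow> u \<in> nbhd E v"
  by (simp add: nbhd_def insert_commute)

lemma not_in_nbhd_self: "u \<notin> nbhd E u"
  using edge[of "{u}"] by (auto simp: nbhd_def)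

lemma indep_sets_iff: "I \<in> indep_sets F E \<longleftrightarrow> I \<subseteq> F \<and> (\<forall>u\<in>I. nbhd E u \<inter> I = {})"
proof
  assume "I \<in> indep_sets F E"
  then show "I \<subseteq> F \<and> (\<forall>u\<in>I. nbhd E u \<inter> I = {})"
    unfolding indep_sets_def nbhd_def by auto
next
  assume *: "I \<subseteq> F \<and> (\<forall>u\<in>I. nbhd E u \<inter> I = {})"
  have "\<not> e \<subseteq> I" if "e \<in> E" for e
  proof
    assume "e \<subseteq> I"
    obtain u v where "e = {u, v}" using edge[OF \<open>e \<in> E\<close>] by auto
    then show False using \<open>e \<subseteq> I\<close> \<open>e \<in> E\<close> * by (auto simp: nbhd_def)
  qed
  then show "I \<in> indep_sets F E" using * by (simp add: indep_sets_def)
qed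

text \<open>\<open>E\<close> stays fixed while the vertex set varies: this is the partition function
  of the subgraph induced on \<open>F\<close>, since an edge not inside \<open>F\<close> does not
  constrain subsets of \<open>F\<close>.\<close>

definition Z :: "'a set \<Rightarrow> real" where
  "Z F = (\<Sum>I\<in>indep_sets F E. lam ^ card I)"

text \<open>Unnormalised occupation probability of \<open>v\<close> in the induced subgraph.\<close>

definition A :: "'a set \<Rightarrow> 'a \<Rightarrow> real" where
  "A F v = (\<Sum>I\<in>{I \<in> indep_sets F E. v \<in> I}. lam ^ card I)"

lemma Z_pos:
  assumes "finite F" shows "Z F > 0"
proof -
  have "{} \<in> indep_sets F E" by (simp add: indep_sets_iff)
  then show ?thesis unfolding Z_def using lam_pos finite_indep_sets[OF assms]
    by (intro sum_pos) auto
qed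

text \<open>Deleting \<open>v\<close> is a bijection onto the independent sets that avoid
  \<open>v\<close> and its neighbours; it costs one factor \<open>lam\<close>.\<close>

lemma A_eq_Z:
  assumes "finite F" "v \<in> F"
  shows "A F v = lam * Z (F - {v} - nbhd E v)"
proof -
  have "A F v = (\<Sum>I\<in>indep_sets (F - {v} - nbhd E v) E. lam ^ Suc (card I))"
    unfolding A_def
  proof (rule sum.reindex_bij_witness[where i = "insert v" and j = "\<lambda>I. I - {v}"])
    fix I assume I: "I \<in> {I \<in> indep_sets F E. v \<in> I}"
    then show "insert v (I - {v}) = I" by auto
    show "I - {v} \<in> indep_sets (F - {v} - nbhd E v) E"
      using I by (auto simp: indep_sets_iff)
    have "finite I" using I finite_of_indep[OF assms(1)] by auto
    then have "Suc (card (I - {v})) = card I"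
      using I by (intro card_Suc_Diff1) auto
    then show "lam ^ Suc (card (I - {v})) = lam ^ card I" by simp
  next
    fix I assume I: "I \<in> indep_sets (F - {v} - nbhd E v) E"
    then show "insert v I - {v} = I" by (auto simp: indep_sets_iff)
    show "insert v I \<in> {I \<in> indep_sets F E. v \<in> I}"
      using I assms(2) nbhd_sym not_in_nbhd_self by (fastforce simp: indep_sets_iff)
  qed
  then show ?thesis by (simp add: Z_def sum_distrib_left)
qed

lemma Z_rec:
  assumes "finite F" "v \<in> F"
  shows "Z F = Z (F - {v}) + lam * Z (F - {v} - nbhd E v)"
proof -
  have "indep_sets F E = indep_sets (F - {v}) E \<union> {I \<in> indep_sets F E. v \<in> I}"
    by (auto simp: indep_sets_def)
  then have "Z F = (\<Sum>I\<in>indep_sets (F - {v}) E \<union> {I \<in> indep_sets F E. v \<in> I}. lam ^ card I)"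
    unfolding Z_def by simp
  also have "\<dots> = Z (F - {v}) + A F v"
    unfolding Z_def A_def using assms finite_indep_sets
    by (intro sum.union_disjoint) (auto simp: indep_sets_iff)
  finally show ?thesis using A_eq_Z[OF assms] by simp
qed

lemma Z_mono:
  assumes "finite F" "F' \<subseteq> F" shows "Z F' \<le> Z F"
  unfolding Z_def using assms lam_pos finite_indep_sets
  by (intro sum_mono2) (auto simp: indep_sets_def)

text \<open>By the recursion and monotonicity, deleting one vertex shrinks \<open>Z\<close> by at
  most the factor \<open>1 + lam\<close>.\<close>

lemma Z_le_Z_Diff:
  assumes "finite F" "finite S" "S \<subseteq> F"
  shows "Z F \<le> (1 + lam) ^ card S * Z (F - S)"
  using assms(2,3)
proof (induction S)
  case (insert x S)
  have "Z (F - S) = Z (F - S - {x}) + lam * Z (F - S - {x} - nbhd E x)"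
    using insert assms(1) by (intro Z_rec) auto
  also have "\<dots> \<le> Z (F - S - {x}) + lam * Z (F - S - {x})"
    using assms(1) lam_pos by (intro add_left_mono mult_left_mono Z_mono) auto
  also have "F - S - {x} = F - insert x S" by auto
  finally have "Z (F - S) \<le> (1 + lam) * Z (F - insert x S)" by (simp add: algebra_simps)
  then have "(1 + lam) ^ card S * Z (F - S) \<le> (1 + lam) ^ card S * ((1 + lam) * Z (F - insert x S))"
    using lam_pos by (intro mult_left_mono) auto
  then show ?case using insert by (simp add: mult_ac)
qed auto

lemma Z_empty: "Z {} = 1"
proof -
  have "indep_sets {} E = {{}}" by (auto simp: indep_sets_iff)
  then show ?thesis by (simp add: Z_def)
qed

lemma Z_le: "finite F \<Longrightarrow> Z F \<le> (1 + lam) ^ card F"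
  using Z_le_Z_Diff[of F F] by (simp add: Z_empty)

text \<open>\<open>Z (F - nbhd E v)\<close> is the weight of the event that no neighbour of
  \<open>v\<close> is occupied; given this event, \<open>v\<close> is free and occupied with
  probability \<open>lam / (1 + lam)\<close>.\<close>

lemma A_eq_uncovered:
  assumes "finite F" "v \<in> F"
  shows "A F v = lam / (1 + lam) * Z (F - nbhd E v)"
proof -
  have "Z (F - nbhd E v)
      = Z (F - nbhd E v - {v}) + lam * Z (F - nbhd E v - {v} - nbhd E v)"
    using assms not_in_nbhd_self by (intro Z_rec) auto
  moreover have "F - nbhd E v - {v} - nbhd E v = F - {v} - nbhd E v"
    "F - nbhd E v - {v} = F - {v} - nbhd E v" by auto
  ultimately have "Z (F - nbhd E v) = (1 + lam) * Z (F - {v} - nbhd E v)"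
    by (simp add: algebra_simps)
  then show ?thesis using A_eq_Z[OF assms] lam_pos by simp
qed

section \<open>Sparse subgraphs: edge counts and average occupancy\<close>

lemma handshake:
  assumes "finite F"
  shows "(\<Sum>v\<in>F. card (F \<inter> nbhd E v)) = 2 * card (induced_edges E F)"
proof -
  have fin: "finite (induced_edges E F)"
    by (rule finite_subset[of _ "Pow F"]) (use assms in \<open>auto simp: induced_edges_def\<close>)
  \<comment> \<open>Double counting of incident vertex-edge pairs: neighbours of \<open>v\<close>
    inside \<open>F\<close> correspond to edges through \<open>v\<close>.\<close>
  have "(\<Sum>v\<in>F. card (F \<inter> nbhd E v)) = (\<Sum>v\<in>F. card {e \<in> induced_edges E F. v \<in> e})"
  proof (rule sum.cong[OF refl])
    fix v assume v: "v \<in> F"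
    have "bij_betw (\<lambda>w. {v, w}) (F \<inter> nbhd E v) {e \<in> induced_edges E F. v \<in> e}"
      unfolding bij_betw_def
    proof
      show "inj_on (\<lambda>w. {v, w}) (F \<inter> nbhd E v)"
        by (auto simp: inj_on_def doubleton_eq_iff)
      show "(\<lambda>w. {v, w}) ` (F \<inter> nbhd E v) = {e \<in> induced_edges E F. v \<in> e}"
      proof
        show "{e \<in> induced_edges E F. v \<in> e} \<subseteq> (\<lambda>w. {v, w}) ` (F \<inter> nbhd E v)"
        proof
          fix e assume e: "e \<in> {e \<in> induced_edges E F. v \<in> e}"
          then have "e \<in> E" "e \<subseteq> F" "v \<in> e" by (auto simp: induced_edges_def)
          moreover then obtain x w where "e = {x, w}" using edge by blast
          ultimately obtain w where "e = {v, w}" by blast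
          then show "e \<in> (\<lambda>w. {v, w}) ` (F \<inter> nbhd E v)"
            using \<open>e \<in> E\<close> \<open>e \<subseteq> F\<close> by (auto simp: nbhd_def)
        qed
      qed (use v in \<open>auto simp: induced_edges_def nbhd_def\<close>)
    qed
    then show "card (F \<inter> nbhd E v) = card {e \<in> induced_edges E F. v \<in> e}"
      by (rule bij_betw_same_card)
  qed
  also have "\<dots> = (\<Sum>v\<in>F. \<Sum>e\<in>induced_edges E F. if v \<in> e then 1 else 0)"
    using fin by (simp add: sum.If_cases Int_def)
  also have "\<dots> = (\<Sum>e\<in>induced_edges E F. \<Sum>v\<in>F. if v \<in> e then 1 else 0)"
    by (rule sum.swap)
  also have "\<dots> = (\<Sum>e\<in>induced_edges E F. card e)"
    using assms by (intro sum.cong refl) (auto simp: sum.If_cases induced_edges_def Int_absorb1)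
  also have "\<dots> = (\<Sum>e\<in>induced_edges E F. 2)"
    by (intro sum.cong refl) (auto simp: induced_edges_def dest!: edge)
  finally show ?thesis by simp
qed

text \<open>The subgraph induced on \<open>F\<close> is one of the finitely many over which the
  maximum is taken. The empty \<open>F\<close> contributes no ratio and is treated apart.\<close>

lemma mad_le_imp_sparse:
  assumes "finite S" "mad S (induced_edges E S) \<le> b" "F \<subseteq> S"
  shows "2 * real (card (induced_edges E F)) \<le> b * real (card F)"
proof (cases "F = {}")
  case True
  then have "induced_edges E F = {}" by (auto simp: induced_edges_def dest: edge)
  then show ?thesis using True by simp
next
  case False
  let ?M = "{2 * real (card FE) / real (card FV) | FV FE. FV \<subseteq> S \<and> FV \<noteq> {} \<and>
    FE \<subseteq> induced_edges E S \<and> (\<forall>e\<in>FE. e \<subseteq> FV)}"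
  have "finite (induced_edges E S)"
    by (rule finite_subset[of _ "Pow S"]) (use assms(1) in \<open>auto simp: induced_edges_def\<close>)
  then have "finite ((\<lambda>(FV, FE). 2 * real (card FE) / real (card FV)) ` (Pow S \<times> Pow (induced_edges E S)))"
    using assms(1) by auto
  then have "finite ?M" by (rule rev_finite_subset) auto
  moreover have "2 * real (card (induced_edges E F)) / real (card F) \<in> ?M"
    using False assms(3)
    by (intro CollectI exI[of _ F] exI[of _ "induced_edges E F"]) (auto simp: induced_edges_def)
  ultimately have "2 * real (card (induced_edges E F)) / real (card F) \<le> mad S (induced_edges E S)"
    using False assms(3) by (auto simp: mad_def)
  moreover have "real (card F) > 0"
    using False assms finite_subset by (auto simp: card_gt_0_iff)
  ultimately have "2 * real (card (induced_edges E F)) \<le> mad S (induced_edges E S) * real (card F)"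
    by (simp add: pos_divide_le_eq)
  also have "\<dots> \<le> b * real (card F)" using assms(2) by (intro mult_right_mono) auto
  finally show ?thesis .
qed

text \<open>By \<open>Z_le_Z_Diff\<close>, \<open>v\<close> has no occupied neighbour with
  probability at least \<open>(1 + lam)\<close> to the power minus its degree in \<open>F\<close>.
  Convexity then allows the average degree, which is at most \<open>b\<close>, to replace the
  individual ones.\<close>

lemma sum_A_ge:
  assumes "finite F" and sparse: "2 * real (card (induced_edges E F)) \<le> b * real (card F)"
  shows "lam / (1 + lam) * (1 + lam) powr (- b) * real (card F) * Z F \<le> (\<Sum>v\<in>F. A F v)"
proof -
  define l where "l = ln (1 + lam)"
  have l: "l > 0" using lam_pos by (simp add: l_def)
  define deg where "deg v = card (F \<inter> nbhd E v)" for v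
  \<comment> \<open>Tangent line of \<open>(1 + lam) powr (- x)\<close> at \<open>x = b\<close>: it
    is affine in the degree, so summation involves the degree sum only.\<close>
  have tangent: "(exp (- l * b) * (1 + l * b) - exp (- l * b) * l * real (deg v)) * Z F \<le> Z (F - nbhd E v)"
    for v
  proof -
    have "exp (- l * b) * (1 + l * b) - exp (- l * b) * l * real (deg v)
        = exp (- l * b) * (1 + (l * b - l * real (deg v)))"
      by (simp add: algebra_simps)
    also have "\<dots> \<le> exp (- l * b) * exp (l * b - l * real (deg v))"
      by (intro mult_left_mono exp_ge_add_one_self) auto
    also have "\<dots> = exp (- (l * real (deg v)))"
      by (simp flip: exp_add)
    also have "\<dots> = inverse ((1 + lam) ^ deg v)"
      using lam_pos by (simp add: exp_minus l_def mult.commute exp_of_nat_mult)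
    finally have "(exp (- l * b) * (1 + l * b) - exp (- l * b) * l * real (deg v)) * Z F
        \<le> inverse ((1 + lam) ^ deg v) * Z F"
      using Z_pos[OF assms(1)] by (intro mult_right_mono) auto
    also have "\<dots> \<le> inverse ((1 + lam) ^ deg v) * ((1 + lam) ^ deg v * Z (F - (F \<inter> nbhd E v)))"
      unfolding deg_def using lam_pos assms(1) by (intro mult_left_mono Z_le_Z_Diff) auto
    also have "\<dots> = Z (F - nbhd E v)"
      using lam_pos by (simp add: Diff_Int)
    finally show ?thesis .
  qed
  have "(\<Sum>v\<in>F. real (deg v)) \<le> b * real (card F)"
    using sparse handshake[OF assms(1)] unfolding deg_def
    by (metis of_nat_mult of_nat_numeral of_nat_sum)
  then have "exp (- l * b) * l * (\<Sum>v\<in>F. real (deg v)) \<le> exp (- l * b) * l * (b * real (card F))"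
    using l by (intro mult_left_mono) auto
  then have "exp (- l * b) * real (card F)
      \<le> exp (- l * b) * (1 + l * b) * real (card F) - exp (- l * b) * l * (\<Sum>v\<in>F. real (deg v))"
    by (simp add: algebra_simps)
  also have "\<dots> = (\<Sum>v\<in>F. exp (- l * b) * (1 + l * b) - exp (- l * b) * l * real (deg v))"
    by (simp add: sum_subtractf sum_distrib_left[symmetric])
  finally have "exp (- l * b) * real (card F) * Z F
      \<le> (\<Sum>v\<in>F. exp (- l * b) * (1 + l * b) - exp (- l * b) * l * real (deg v)) * Z F"
    using Z_pos[OF assms(1)] by (intro mult_right_mono) auto
  also have "\<dots> \<le> (\<Sum>v\<in>F. Z (F - nbhd E v))"
    unfolding sum_distrib_right by (intro sum_mono tangent)
  finally have "lam / (1 + lam) * (exp (- l * b) * real (card F) * Z F)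
      \<le> lam / (1 + lam) * (\<Sum>v\<in>F. Z (F - nbhd E v))"
    using lam_pos by (intro mult_left_mono) auto
  also have "\<dots> = (\<Sum>v\<in>F. A F v)"
    unfolding sum_distrib_left by (intro sum.cong refl) (simp add: A_eq_uncovered assms(1))
  also have "exp (- l * b) = (1 + lam) powr (- b)"
    using lam_pos by (simp add: powr_def l_def mult.commute)
  finally show ?thesis by (simp add: mult_ac)
qed

section \<open>Conditioning on the configuration outside a vertex set\<close>

lemma sum_indep_sets_split:
  assumes "finite V" "S \<subseteq> V"
  shows "(\<Sum>I\<in>indep_sets V E. lam ^ card I * f (I \<inter> S))
    = (\<Sum>J\<in>indep_sets (V - S) E. lam ^ card J *
        (\<Sum>K\<in>indep_sets {v \<in> S. nbhd E v \<inter> J = {}} E. lam ^ card K * (f K :: real)))"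
proof -
  \<comment> \<open>Spatial Markov property: the outer part \<open>J\<close> is any independent set
    off \<open>S\<close>; given \<open>J\<close>, the inner part is any independent set of vertices
    of \<open>S\<close> without a neighbour in \<open>J\<close>.\<close>
  define P where "P = Sigma (indep_sets (V - S) E) (\<lambda>J. indep_sets {v \<in> S. nbhd E v \<inter> J = {}} E)"
  have fS: "finite S" using assms finite_subset by blast
  have "(\<Sum>I\<in>indep_sets V E. lam ^ card I * f (I \<inter> S))
      = (\<Sum>(J, K)\<in>P. lam ^ card J * (lam ^ card K * f K))"
  proof (rule sum.reindex_bij_witness[where i = "\<lambda>(J, K). J \<union> K" and j = "\<lambda>I. (I - S, I \<inter> S)"])
    fix I assume I: "I \<in> indep_sets V E"
    show "(case (I - S, I \<inter> S) of (J, K) \<Rightarrow> J \<union> K) = I" by auto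
    show "(I - S, I \<inter> S) \<in> P" using I by (auto simp: P_def indep_sets_iff)
    have "finite I" using I assms(1) finite_of_indep by blast
    then have "card I = card (I - S) + card (I \<inter> S)"
      by (metis Int_Diff_disjoint Un_Diff_Int card_Un_disjoint finite_Diff finite_Int inf_commute)
    then show "(case (I - S, I \<inter> S) of (J, K) \<Rightarrow> lam ^ card J * (lam ^ card K * f K))
        = lam ^ card I * f (I \<inter> S)" by (simp add: power_add)
  next
    fix p assume p: "p \<in> P"
    obtain J K where pJK: "p = (J, K)" by force
    have J: "J \<subseteq> V - S" "\<And>u. u \<in> J \<Longrightarrow> nbhd E u \<inter> J = {}"
      and K: "K \<subseteq> S" "\<And>u. u \<in> K \<Longrightarrow> nbhd E u \<inter> K = {}" "\<And>u. u \<in> K \<Longrightarrow> nbhd E u \<inter> J = {}"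
      using p by (auto simp: P_def pJK indep_sets_iff)
    have JK: "nbhd E u \<inter> K = {}" if "u \<in> J" for u
      using K(3) nbhd_sym that by blast
    have "nbhd E u \<inter> (J \<union> K) = {}" if "u \<in> J \<union> K" for u
      using that J(2)[of u] JK[of u] K(2,3)[of u] by (auto simp: Int_Un_distrib)
    then show "(case p of (J, K) \<Rightarrow> J \<union> K) \<in> indep_sets V E"
      using J(1) K(1) assms(2) by (auto simp: pJK indep_sets_iff)
    show "((case p of (J, K) \<Rightarrow> J \<union> K) - S, (case p of (J, K) \<Rightarrow> J \<union> K) \<inter> S) = p"
      using J(1) K(1) by (auto simp: pJK)
  qed
  also have "\<dots> = (\<Sum>J\<in>indep_sets (V - S) E. \<Sum>K\<in>indep_sets {v \<in> S. nbhd E v \<inter> J = {}} E.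
      lam ^ card J * (lam ^ card K * f K))"
    unfolding P_def using assms fS by (subst sum.Sigma) (auto intro!: finite_indep_sets)
  finally show ?thesis by (simp add: sum_distrib_left)
qed

text \<open>The parameter \<open>w\<close> is free: the bound is the tangent line of \<open>exp\<close> at \<open>- w\<close>.
  \<open>Z (V - nbhd E v) / Z V\<close> is the probability that no neighbour of \<open>v\<close> is occupied.\<close>

lemma local_occupancy:
  assumes fin: "finite V" and sub: "nbhd E u \<subseteq> V"
    and sparse: "\<And>F. F \<subseteq> nbhd E u \<Longrightarrow> 2 * real (card (induced_edges E F)) \<le> b * real (card F)"
  shows "exp (- w) * ((1 + w) * Z V
      - (1 + lam) powr b * ln (1 + lam) * (\<Sum>v\<in>nbhd E u. Z (V - nbhd E v))) \<le> Z (V - nbhd E u)"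
proof -
  define S where "S = nbhd E u"
  have fS: "finite S" using fin sub finite_subset by (auto simp: S_def)
  define F where "F J = {v \<in> S. nbhd E v \<inter> J = {}}" for J
  have F: "F J \<subseteq> S" "finite (F J)" for J using fS by (auto simp: F_def)
  define l where "l = ln (1 + lam)"
  have l: "l > 0" using lam_pos by (simp add: l_def)
  \<comment> \<open>Reciprocal of the factor in front of \<open>card F * Z F\<close> in
    \<open>sum_A_ge\<close>.\<close>
  define c where "c = (1 + lam) powr b * ((1 + lam) / lam)"
  have Z_split: "Z V = (\<Sum>J\<in>indep_sets (V - S) E. lam ^ card J * Z (F J))"
    using sum_indep_sets_split[OF fin, of S "\<lambda>_. 1"] sub by (simp add: Z_def F_def S_def)
  have A_split: "A V v = (\<Sum>J\<in>indep_sets (V - S) E. lam ^ card J * A (F J) v)" if "v \<in> S" for v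
  proof -
    have A_if: "A T v = (\<Sum>I\<in>indep_sets T E. lam ^ card I * (if v \<in> I then 1 else 0))"
      if "finite T" for T
      unfolding A_def using finite_indep_sets[OF that]
      by (simp add: sum.inter_filter if_distrib cong: if_cong)
    show ?thesis
      using sum_indep_sets_split[OF fin, of S "\<lambda>I. if v \<in> I then 1 else 0"] sub that
      unfolding A_if[OF fin] A_if[OF F(2)] by (simp add: F_def S_def)
  qed
  have A0: "A T v = 0" if "v \<notin> T" for T v
  proof -
    have none: "{I \<in> indep_sets T E. v \<in> I} = {}" using that by (auto simp: indep_sets_iff)
    show ?thesis unfolding A_def none by simp
  qed
  \<comment> \<open>Let \<open>m\<close> be the number of vertices of \<open>S\<close> left free by
    \<open>J\<close>. By \<open>sum_A_ge\<close> the occupancy sum is at least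
    \<open>m * Z (F J) / c\<close>; the tangent line of \<open>exp\<close> turns
    \<open>1 + w - l * m\<close> into \<open>(1 + lam)\<close> to the power \<open>-m\<close>, and
    \<open>Z_le\<close> cancels that power.\<close>
  have occupancy: "exp (- w) * ((1 + w) * Z (F J) - l * c * (\<Sum>v\<in>S. A (F J) v)) \<le> 1" for J
  proof -
    have "lam / (1 + lam) * (1 + lam) powr (- b) * real (card (F J)) * Z (F J) \<le> (\<Sum>v\<in>F J. A (F J) v)"
      using F sparse by (intro sum_A_ge) (auto simp: S_def)
    also have "\<dots> = (\<Sum>v\<in>S. A (F J) v)"
      using fS F A0 by (intro sum.mono_neutral_left) auto
    finally have "c * (lam / (1 + lam) * (1 + lam) powr (- b) * real (card (F J)) * Z (F J))
        \<le> c * (\<Sum>v\<in>S. A (F J) v)"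
      using lam_pos by (intro mult_left_mono) (auto simp: c_def)
    also have "c * (lam / (1 + lam) * (1 + lam) powr (- b) * real (card (F J)) * Z (F J))
        = real (card (F J)) * Z (F J)"
    proof -
      have "p * (m / lam) * (lam / m * inverse p * x * z) = x * z" if "p \<noteq> 0" "m \<noteq> 0" for p m x z
        using that lam_pos by simp
      then show ?thesis using lam_pos by (simp add: c_def powr_minus)
    qed
    finally have "l * (real (card (F J)) * Z (F J)) \<le> l * (c * (\<Sum>v\<in>S. A (F J) v))"
      using l by (intro mult_left_mono) auto
    then have "exp (- w) * ((1 + w) * Z (F J) - l * c * (\<Sum>v\<in>S. A (F J) v))
        \<le> exp (- w) * ((1 + w) * Z (F J) - l * (real (card (F J)) * Z (F J)))"
      by (intro mult_left_mono) (auto simp: mult.assoc)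
    also have "\<dots> = exp (- w) * (1 + (w - l * real (card (F J)))) * Z (F J)"
      by (simp add: algebra_simps)
    also have "\<dots> \<le> exp (- w) * exp (w - l * real (card (F J))) * Z (F J)"
      using Z_pos[OF F(2), of J] by (intro mult_right_mono mult_left_mono exp_ge_add_one_self) auto
    also have "\<dots> = exp (- (l * real (card (F J)))) * Z (F J)"
      by (simp flip: exp_add)
    also have "\<dots> = inverse ((1 + lam) ^ card (F J)) * Z (F J)"
      using lam_pos by (simp add: exp_minus l_def mult.commute exp_of_nat_mult)
    also have "\<dots> \<le> inverse ((1 + lam) ^ card (F J)) * (1 + lam) ^ card (F J)"
      using lam_pos F by (intro mult_left_mono Z_le) auto
    also have "\<dots> = 1" using lam_pos by simp
    finally show ?thesis .
  qed
  have "c * (\<Sum>v\<in>S. A V v) = (1 + lam) powr b * (\<Sum>v\<in>S. Z (V - nbhd E v))"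
    unfolding sum_distrib_left
  proof (rule sum.cong[OF refl])
    fix v assume "v \<in> S"
    then have "v \<in> V" using sub by (auto simp: S_def)
    then show "c * A V v = (1 + lam) powr b * Z (V - nbhd E v)"
      using lam_pos by (simp add: A_eq_uncovered[OF fin] c_def)
  qed
  then have "exp (- w) * ((1 + w) * Z V - (1 + lam) powr b * l * (\<Sum>v\<in>S. Z (V - nbhd E v)))
      = exp (- w) * ((1 + w) * Z V - l * c * (\<Sum>v\<in>S. A V v))"
    by (simp add: mult_ac)
  also have "(\<Sum>v\<in>S. A V v) = (\<Sum>J\<in>indep_sets (V - S) E. lam ^ card J * (\<Sum>v\<in>S. A (F J) v))"
    using A_split by (subst sum_distrib_left, subst sum.swap) (intro sum.cong refl, auto)
  also have "exp (- w) * ((1 + w) * Z V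
        - l * c * (\<Sum>J\<in>indep_sets (V - S) E. lam ^ card J * (\<Sum>v\<in>S. A (F J) v)))
      = (\<Sum>J\<in>indep_sets (V - S) E.
          lam ^ card J * (exp (- w) * ((1 + w) * Z (F J) - l * c * (\<Sum>v\<in>S. A (F J) v))))"
    unfolding Z_split sum_distrib_left sum_subtractf[symmetric]
    by (intro sum.cong refl) (simp add: sum_distrib_left[symmetric] algebra_simps)
  \<comment> \<open>The bound 1 is the weight of the empty inner configuration, so summing over
    \<open>J\<close> gives the weight of all independent sets that avoid \<open>S\<close>.\<close>
  also have "\<dots> \<le> (\<Sum>J\<in>indep_sets (V - S) E. lam ^ card J * 1)"
    using lam_pos by (intro sum_mono mult_left_mono occupancy) auto
  also have "\<dots> = Z (V - S)" by (simp add: Z_def)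
  finally show ?thesis by (simp add: S_def l_def)
qed

text \<open>Linearity of expectation over vertices, followed by
  \<open>A_eq_uncovered\<close>.\<close>

lemma expected_size_eq:
  assumes "finite V"
  shows "hc_expected_size V E (\<lambda>_. lam) = lam / (1 + lam) * (\<Sum>v\<in>V. Z (V - nbhd E v) / Z V)"
proof -
  have "hc_Z V E (\<lambda>_. lam) = Z V" by (simp add: hc_Z_def hc_weight_def Z_def)
  then have "hc_expected_size V E (\<lambda>_. lam)
      = (\<Sum>I\<in>indep_sets V E. real (card I) * lam ^ card I) / Z V"
    by (simp add: hc_expected_size_def hc_prob_def hc_weight_def sum_divide_distrib)
  also have "(\<Sum>I\<in>indep_sets V E. real (card I) * lam ^ card I)
      = (\<Sum>I\<in>indep_sets V E. \<Sum>v\<in>V. if v \<in> I then lam ^ card I else 0)"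
  proof (rule sum.cong[OF refl])
    fix I assume "I \<in> indep_sets V E"
    then have "V \<inter> I = I" by (auto simp: indep_sets_iff)
    then show "real (card I) * lam ^ card I = (\<Sum>v\<in>V. if v \<in> I then lam ^ card I else 0)"
      using assms by (simp add: sum.If_cases)
  qed
  also have "\<dots> = (\<Sum>v\<in>V. A V v)"
    unfolding A_def using finite_indep_sets[OF assms]
    by (subst sum.swap) (simp add: sum.inter_filter)
  also have "\<dots> = (\<Sum>v\<in>V. lam / (1 + lam) * Z (V - nbhd E v))"
    by (intro sum.cong refl A_eq_uncovered assms)
  finally show ?thesis by (simp add: sum_distrib_left sum_divide_distrib)
qed

end

section \<open>The bound\<close>

text \<open>The definite description is well defined: a solution exists by the intermediate value
  theorem on \<open>[0, y]\<close>, as \<open>y * exp y \<ge> y\<close>, and is unique by strict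
  monotonicity.\<close>

lemma lambertW:
  assumes "y > 0"
  shows "lambertW y > 0" "lambertW y * exp (lambertW y) = y"
proof -
  have mono: "a * exp a < b * exp b" if "0 < a" "a < b" for a b :: real
    using that by (intro mult_strict_mono) auto
  have "\<exists>w\<ge>0. w \<le> y \<and> w * exp w = y"
    using assms mult_left_mono[of 1 "exp y" y]
    by (intro IVT') (auto intro!: continuous_intros)
  then obtain w where w: "w > 0" "w * exp w = y"
    using assms by (metis less_eq_real_def mult_zero_left)
  have "\<exists>!w. w > 0 \<and> w * exp w = y"
    using w mono by (intro ex1I[of _ w]) (auto, metis less_irrefl linorder_neqE_linordered_idom)
  from theI'[OF this] show "lambertW y > 0" "lambertW y * exp (lambertW y) = y"
    by (simp_all add: lambertW_def)
qed

text \<open>For \<open>g = exp (- w)\<close> and \<open>h = \<kappa> * exp (- w) / (1 + w)\<close>,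
  this bounds the rate of change of \<open>h / \<kappa>\<close> with respect to \<open>g\<close>, as
  the comparison principle requires.\<close>

lemma slope_bounds:
  fixes a b :: real
  assumes "0 \<le> a" "a \<le> b" "a \<le> 1/8"
  shows "8/9 * (exp (- a) - exp (- b)) \<le> exp (- a) / (1 + a) - exp (- b) / (1 + b)"
    and "exp (- a) / (1 + a) - exp (- b) / (1 + b) \<le> 2 * (exp (- a) - exp (- b))"
proof -
  \<comment> \<open>Numerator and denominator are varied separately, giving two nonnegative terms.
    The lower bound keeps the first, with 8/9 = 1 / (1 + 1/8); for the upper bound each term is at
    most \<open>exp (- a) - exp (- b)\<close>.\<close>
  have split: "exp (- a) / (1 + a) - exp (- b) / (1 + b)
      = (exp (- a) - exp (- b)) / (1 + a) + exp (- b) * (b - a) / ((1 + a) * (1 + b))"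
  proof -
    have *: "1 / (1 + a) - 1 / (1 + b) = (b - a) / ((1 + a) * (1 + b))"
      using assms by (simp add: field_simps)
    show ?thesis
      unfolding times_divide_eq_right[symmetric] *[symmetric] by (simp add: algebra_simps diff_divide_distrib)
  qed
  have d: "exp (- a) - exp (- b) \<ge> 0" using assms by simp
  have "8/9 * (exp (- a) - exp (- b)) \<le> 1 / (1 + a) * (exp (- a) - exp (- b))"
    using assms d by (intro mult_right_mono) (auto simp: field_simps)
  moreover have "0 \<le> exp (- b) * (b - a) / ((1 + a) * (1 + b))" using assms by auto
  ultimately show "8/9 * (exp (- a) - exp (- b)) \<le> exp (- a) / (1 + a) - exp (- b) / (1 + b)"
    unfolding split by (simp only: mult_1 times_divide_eq_left)
  have "exp (- b) * (1 + (b - a)) \<le> exp (- b) * exp (b - a)"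
    by (intro mult_left_mono exp_ge_add_one_self) auto
  also have "\<dots> = exp (- a)" by (simp flip: exp_add)
  finally have e: "exp (- b) * (b - a) \<le> exp (- a) - exp (- b)" by (simp add: algebra_simps)
  have "(exp (- a) - exp (- b)) / (1 + a) \<le> (exp (- a) - exp (- b)) / 1"
    using assms d by (intro divide_left_mono) auto
  moreover have "1 * 1 \<le> (1 + a) * (1 + b)" using assms by (intro mult_mono) auto
  then have "exp (- b) * (b - a) / ((1 + a) * (1 + b)) \<le> exp (- b) * (b - a) / 1"
    using assms by (intro divide_left_mono) auto
  ultimately show "exp (- a) / (1 + a) - exp (- b) / (1 + b) \<le> 2 * (exp (- a) - exp (- b))"
    unfolding split using e by simp
qed

text \<open>The numerical constants enter here. For \<open>b = 0\<close> the product is below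
  0.1096; for \<open>b \<ge> 1\<close> the power costs at most 100/91 and the product stays below
  0.0986.\<close>

lemma kappa_le:
  assumes "b = 0 \<or> b \<ge> 1" "0 < lam" "lam < cconst b / \<Delta>" "\<Delta> \<ge> 1"
  shows "(1 + lam) powr b * ln (1 + lam) * \<Delta> \<le> 1 / 8"
proof -
  have l: "ln (1 + lam) \<le> lam" using assms by (intro ln_add_one_self_le_self) auto
  have lD: "lam * \<Delta> < cconst b" using assms by (simp add: field_simps)
  show ?thesis
  proof (cases "b = 0")
    case True
    have "ln (1 + lam) * \<Delta> \<le> lam * \<Delta>" using l assms by (intro mult_right_mono) auto
    also have "\<dots> \<le> 1 / 8" using lD True by (simp add: cconst_def)
    finally show ?thesis using assms True by simp
  next
    case False
    then have b: "b \<ge> 1" using assms by auto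
    then have 1: "lam * \<Delta> * b < 0.0896883" using lD by (simp add: cconst_def field_simps)
    have "lam * b * 1 \<le> lam * b * \<Delta>" using assms b by (intro mult_left_mono) auto
    then have 2: "lam * b \<le> 9/100" using 1 by (simp add: mult_ac)
    have 3: "lam * \<Delta> * 1 \<le> lam * \<Delta> * b" using assms b by (intro mult_left_mono) auto
    have "b * ln (1 + lam) \<le> b * lam" using l b by (intro mult_left_mono) auto
    then have "(1 + lam) powr b \<le> exp (lam * b)"
      using assms by (simp add: powr_def mult.commute)
    also have "\<dots> \<le> exp (9/100)" using 2 by simp
    also have "\<dots> \<le> 100 / 91"
    proof -
      \<comment> \<open>The factor 100/91 comes from \<open>exp (- x) \<ge> 1 - x\<close> at
        \<open>x = 9/100\<close>.\<close>
      have "91/100 \<le> exp (- (9/100) :: real)" using exp_ge_add_one_self[of "- (9/100)"] by simp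
      then show ?thesis by (simp add: exp_minus field_simps)
    qed
    finally have "(1 + lam) powr b * ln (1 + lam) \<le> 100 / 91 * lam"
      using l assms by (intro mult_mono) auto
    then have "(1 + lam) powr b * ln (1 + lam) * \<Delta> \<le> 100 / 91 * lam * \<Delta>"
      using assms by (intro mult_right_mono) auto
    then show ?thesis using 1 3 by simp
  qed
qed

section \<open>Assembly of the estimates\<close>

theorem theorem1p2:
  fixes V :: "'a set" and E :: "'a set set" and b lam :: real
  assumes "simple_graph V E"
    and "\<forall>u\<in>V. degree E u \<ge> 1"
    and "b = 0 \<or> b \<ge> 1"
    and "\<forall>u\<in>V. mad (nbhd E u) (induced_edges E (nbhd E u)) \<le> b"
    and "0 < lam" and "lam < cconst b / real (max_degree V E)"
  shows "hc_expected_size V E (\<lambda>_. lam) \<ge>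
    (\<Sum>u\<in>V. let d = real (degree E u);
                D = d * (1 + lam) powr b * ln (1 + lam);
                \<beta> = (1 + lam) / lam * (D / (lambertW D * (1 + lambertW D)));
                \<gamma> = (1 + lam) / lam * (D / (d * (1 + lambertW D)))
            in 1 / (\<beta> + d * \<gamma>))"
proof -
  have fin: "finite V" using assms(1) by (simp add: simple_graph_def)
  interpret hard_core E lam
    using assms(1,5) unfolding simple_graph_def by unfold_locales blast+
  have sub: "nbhd E u \<subseteq> V" for u
  proof
    fix v assume "v \<in> nbhd E u"
    then obtain x y where "{u, v} = {x, y}" "x \<in> V" "y \<in> V"
      using assms(1) unfolding nbhd_def simple_graph_def by blast
    then show "v \<in> V" by (metis doubleton_eq_iff)
  qed
  interpret nbhd_system V "nbhd E"
    using fin sub nbhd_sym by unfold_locales auto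
  define \<Delta> where "\<Delta> = real (max_degree V E)"
  define \<kappa> where "\<kappa> = (1 + lam) powr b * ln (1 + lam)"
  have \<kappa>: "\<kappa> > 0" using assms(5) by (simp add: \<kappa>_def)
  have deg_le: "real (card (nbhd E u)) \<le> \<Delta>" if "u \<in> V" for u
    unfolding \<Delta>_def max_degree_def degree_def[symmetric] using fin that by simp
  have deg_pos: "real (degree E u) \<ge> 1" if "u \<in> V" for u
    using assms(2) that by auto
  define w where "w u = lambertW (real (degree E u) * (1 + lam) powr b * ln (1 + lam))" for u
  have w: "w u > 0" "w u * exp (w u) = real (degree E u) * \<kappa>" if "u \<in> V" for u
    using lambertW[of "real (degree E u) * (1 + lam) powr b * ln (1 + lam)"] deg_pos[OF that] assms(5)
    by (auto simp: w_def \<kappa>_def mult.assoc)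
  define g where "g u = exp (- w u)" for u
  define h where "h u = \<kappa> * (exp (- w u) / (1 + w u))" for u
  define q where "q u = Z (V - nbhd E u) / Z V" for u
  have summand: "(let d = real (degree E u);
                D = d * (1 + lam) powr b * ln (1 + lam);
                \<beta> = (1 + lam) / lam * (D / (lambertW D * (1 + lambertW D)));
                \<gamma> = (1 + lam) / lam * (D / (d * (1 + lambertW D)))
            in 1 / (\<beta> + d * \<gamma>)) = lam / (1 + lam) * g u" if u: "u \<in> V" for u
  proof -
    let ?d = "real (degree E u)"
    \<comment> \<open>With \<open>D = w * exp w\<close>, the terms \<open>\<beta>\<close> and
      \<open>d * \<gamma>\<close> are \<open>(1 + lam) / lam * exp w\<close> times
      \<open>1 / (1 + w)\<close> and \<open>w / (1 + w)\<close>; these two fractions add up to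
      1.\<close>
    have D: "?d * (1 + lam) powr b * ln (1 + lam) = w u * exp (w u)"
      using w[OF u] by (simp add: \<kappa>_def mult.assoc)
    have "(1 + lam) / lam * (w u * exp (w u) / (w u * (1 + w u)))
        + ?d * ((1 + lam) / lam * (w u * exp (w u) / (?d * (1 + w u))))
        = (1 + lam) / lam * exp (w u) * ((1 + w u) / (1 + w u))"
      using w(1)[OF u] deg_pos[OF u] assms(5) by (simp add: divide_simps) (simp add: algebra_simps)
    also have "\<dots> = (1 + lam) / lam * exp (w u)" using w(1)[OF u] by simp
    finally have "(1 + lam) / lam * (w u * exp (w u) / (w u * (1 + w u)))
        + ?d * ((1 + lam) / lam * (w u * exp (w u) / (?d * (1 + w u))))
        = (1 + lam) / lam * exp (w u)" .
    moreover have "1 / ((1 + lam) / lam * exp (w u)) = lam / (1 + lam) * g u"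
      by (simp add: g_def exp_minus divide_inverse)
    ultimately show ?thesis
      unfolding Let_def w_def[symmetric] unfolding D by (simp only:)
  qed
  have "(\<Sum>u\<in>V. g u) \<le> (\<Sum>u\<in>V. q u)"
  proof (cases "V = {}")
    case False
    then obtain u0 where u0: "u0 \<in> V" by auto
    have \<Delta>: "\<Delta> \<ge> 1" using deg_pos[OF u0] deg_le[OF u0] by (simp add: degree_def)
    have small: "\<kappa> * \<Delta> \<le> 1 / 8"
      unfolding \<kappa>_def using assms \<Delta> by (intro kappa_le) (auto simp: \<Delta>_def)
    have w_le: "w u \<le> 1 / 8" if "u \<in> V" for u
    proof -
      have "w u * 1 \<le> w u * exp (w u)" using w(1)[OF that] by (intro mult_left_mono) auto
      also have "\<dots> \<le> \<Delta> * \<kappa>"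
        unfolding w(2)[OF that] degree_def using \<kappa> deg_le[OF that] by (intro mult_right_mono) auto
      finally show ?thesis using small by (simp add: mult.commute)
    qed
    have slopes: "8/9 * (g u - g v) * \<kappa> \<le> h u - h v \<and> h u - h v \<le> 2 * (g u - g v) * \<kappa> \<and> g v \<le> g u"
      if "u \<in> V" "v \<in> V" "w u \<le> w v" for u v
    proof -
      have "h u - h v = (exp (- w u) / (1 + w u) - exp (- w v) / (1 + w v)) * \<kappa>"
        by (simp add: h_def algebra_simps)
      then show ?thesis
        using slope_bounds[of "w u" "w v"] w(1)[OF that(1)] w_le[OF that(1)] that(3) \<kappa>
        by (auto simp: g_def intro!: mult_right_mono)
    qed
    show ?thesis
    proof (rule sum_ge_of_laplacian_supersolution[of \<Delta> h \<kappa>])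
      fix u v assume uv: "u \<in> V" "v \<in> V"
      \<comment> \<open>Both sides are symmetric in \<open>u\<close> and \<open>v\<close>, so the
        pair may be ordered by \<open>w\<close>, which makes the differences of \<open>g\<close> and
        \<open>h\<close> nonnegative.\<close>
      have ordered: "8/9 * \<kappa> * (g u - g v)\<^sup>2 \<le> (g u - g v) * (h u - h v)"
        if "u \<in> V" "v \<in> V" "w u \<le> w v" for u v
        using slopes[OF that] mult_left_mono[of "8/9 * (g u - g v) * \<kappa>" "h u - h v" "g u - g v"]
        by (simp add: power2_eq_square mult_ac)
      show "8/9 * \<kappa> * (g u - g v)\<^sup>2 \<le> (g u - g v) * (h u - h v)"
      proof (cases "w u \<le> w v")
        case False
        then have "8/9 * \<kappa> * (g v - g u)\<^sup>2 \<le> (g v - g u) * (h v - h u)"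
          using uv by (intro ordered) auto
        then show ?thesis
          by (metis minus_diff_eq minus_mult_minus power2_commute)
      qed (use uv ordered in auto)
      have ordered': "\<bar>h u - h v\<bar> \<le> 2 * \<kappa> * \<bar>g u - g v\<bar>"
        if "u \<in> V" "v \<in> V" "w u \<le> w v" for u v
      proof -
        have "0 \<le> 8/9 * (g u - g v) * \<kappa>" using slopes[OF that] \<kappa> by simp
        then have "\<bar>h u - h v\<bar> = h u - h v" using slopes[OF that] by linarith
        also have "\<dots> \<le> 2 * \<kappa> * (g u - g v)" using slopes[OF that] by (simp add: mult_ac)
        also have "g u - g v = \<bar>g u - g v\<bar>" using slopes[OF that] by simp
        finally show ?thesis .
      qed
      show "\<bar>h u - h v\<bar> \<le> 2 * \<kappa> * \<bar>g u - g v\<bar>"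
      proof (cases "w u \<le> w v")
        case False
        then have "\<bar>h v - h u\<bar> \<le> 2 * \<kappa> * \<bar>g v - g u\<bar>"
          using uv by (intro ordered') auto
        then show ?thesis by (simp only: abs_minus_commute)
      qed (use uv ordered' in auto)
    next
      fix u assume u: "u \<in> V"
      show "0 \<le> h u" using w(1)[OF u] \<kappa> by (simp add: h_def)
      have "exp (- w u) \<le> 1" using w(1)[OF u] by simp
      then have "exp (- w u) \<le> 1 + w u" using w(1)[OF u] by linarith
      then show "h u \<le> \<kappa>"
        using w(1)[OF u] \<kappa> by (simp add: h_def pos_divide_le_eq)
      \<comment> \<open>The fixed-point equation for \<open>g\<close>, read off in the
        exponent.\<close>
      have gw: "real (card (nbhd E u)) * \<kappa> * g u = w u"
        using w(2)[OF u] by (simp add: g_def degree_def exp_minus field_simps)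
      \<comment> \<open>The tangent point is \<open>w u\<close>, so that the bound reproduces
        \<open>g u\<close> if \<open>q\<close> equals \<open>g u\<close> at every neighbour.\<close>
      have "exp (- w u) * ((1 + w u) * Z V - \<kappa> * (\<Sum>v\<in>nbhd E u. Z (V - nbhd E v))) \<le> Z (V - nbhd E u)"
        unfolding \<kappa>_def
      proof (rule local_occupancy[OF fin sub])
        fix F assume "F \<subseteq> nbhd E u"
        then show "2 * real (card (induced_edges E F)) \<le> b * real (card F)"
          using assms(4) u finite_N[OF u] by (intro mad_le_imp_sparse) auto
      qed
      then have "exp (- w u) * ((1 + w u) * Z V - \<kappa> * (\<Sum>v\<in>nbhd E u. Z (V - nbhd E v))) / Z V \<le> q u"
        unfolding q_def using Z_pos[OF fin] by (intro divide_right_mono) auto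
      also have "exp (- w u) * ((1 + w u) * Z V - \<kappa> * (\<Sum>v\<in>nbhd E u. Z (V - nbhd E v))) / Z V
          = g u * (1 + w u - \<kappa> * (\<Sum>v\<in>nbhd E u. q v))"
        using Z_pos[OF fin] by (simp add: g_def q_def sum_divide_distrib[symmetric] field_simps)
      finally have "g u * (1 + w u - \<kappa> * (\<Sum>v\<in>nbhd E u. q v)) \<le> q u" .
      \<comment> \<open>The neighbour sum is traded for the Laplacian; by \<open>gw\<close> the
        diagonal part is \<open>w u * q u\<close>. Moving it to the right and dividing by
        \<open>1 + w u\<close> produces \<open>h\<close>.\<close>
      moreover have "\<kappa> * g u * lap q u = w u * q u - \<kappa> * g u * (\<Sum>v\<in>nbhd E u. q v)"
        unfolding lap_def sum_subtractf gw[symmetric] by (simp add: algebra_simps)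
      ultimately have "g u * (1 + w u) + \<kappa> * g u * lap q u \<le> q u * (1 + w u)"
        by (simp add: algebra_simps)
      then show "g u + h u * lap q u \<le> q u"
        using w(1)[OF u] by (simp add: h_def g_def[symmetric] field_simps)
    qed (use deg_le small \<kappa> \<Delta> in auto)
  qed simp
  then have "lam / (1 + lam) * (\<Sum>u\<in>V. g u) \<le> lam / (1 + lam) * (\<Sum>u\<in>V. q u)"
    using assms(5) by (intro mult_left_mono) auto
  also have "\<dots> = hc_expected_size V E (\<lambda>_. lam)"
    by (simp add: expected_size_eq[OF fin] q_def)
  finally show ?thesis
    by (simp only: summand sum_distrib_left cong: sum.cong)
qed

end
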